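(* Let $i$ and $k$ be arbitrary nonnegative integers and $-1\le l\le 2i+1$. (1) The polynomials $\mathfrak{b}^l_{i,0}$ and $\Delta$ are two first integrals for ${\rm B}^l_{i,k}$, i.e. ${\rm B}^l_{i,k}(\mathfrak{b}^l_{i,0})=0$ and ${\rm B}^l_{i,k}(\Delta)=0$. Indeed, for every $v\in\mathscr{B}$, $\Psi^{-1}(v)\in\mathfrak{B}$ and $\Delta$ are two first integrals for $v$. (2) A Clebsch potential representation for ${\rm B}^l_{i,k}$ is given by $${\rm B}^l_{i,k}=\Delta^k\big(\nabla\mathfrak{b}^l_{i,0}\times\nabla\Delta\big).$$ This provides an alternative representation for each vector field $v$ in $\mathscr{B}$ by using the primary and secondary Clebsch potentials $\Delta$ and $\Psi^{-1}(v)\in\mathfrak{B}$. (3) The polynomial functions $\mathfrak{b}^l_{i,0}$ and $\Delta$ are two functionally independent first integrals for ${\rm B}^l_{i,0}$. (4) The rings of invariants for ${\rm B}^{-1}_{i,k}$, ${\rm B}^{i}_{i,k}$ and ${\rm B}^{2i+1}_{i,k}$ include $\langle\Delta,z\rangle$, $\langle\Delta,y\rangle$ and $\langle\Delta,x\rangle$, respectively.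
   Context: Work over $\mathbb{R}$ with coordinates $(x,y,z)$, $\Delta:=xz-y^2$, $\mathbb{N}_0=\mathbb{N}\cup\{0\}$. Vector fields are identified both with derivations and with triples of components; $[v,w]=vw-wv$, ${\rm ad}_vw=[v,w]$. Let ${\rm N}=x\frac{\partial}{\partial y}+2y\frac{\partial}{\partial z}$, ${\rm M}=z\frac{\partial}{\partial y}+2y\frac{\partial}{\partial x}$, $\kappa_{l,m}:=\frac{m!}{(m-l)!}$. For $i,k\in\mathbb{N}_0$, $-1\le l\le 2i+1$ define $${\rm B}^l_{i,k}:=\frac{{\rm ad}_{\rm N}^{\,l+1}(z^i\Delta^k{\rm M})}{\kappa_{l+1,2i+2}},\qquad \mathfrak{b}^l_{i,k}:=-\frac{{\rm N}^{l+1}(z^{i+1}\Delta^k)}{(i+1)\kappa_{l+1,2i+2}},$$ where in the second formula ${\rm N}$ acts on functions as a differential operator. Let $\mathscr{B}:={\rm span}\{{\rm B}^1_{0,0}+\sum b^l_{i,k}{\rm B}^l_{i,k}\mid -1\le l\le 2i+1,\ i\in\mathbb{N},\ k\in\mathbb{N}_0,\ b^l_{i,k}\in\mathbb{R}\}$ and $\mathfrak{B}:={\rm span}\{\mathfrak{b}^1_{0,0}+\sum\beta^l_{i,k}\mathfrak{b}^l_{i,k}\mid -1\le l\le 2i+1,\ i,k\in\mathbb{N}_0,\ \beta^l_{i,k}\in\mathbb{R}\}$ (formal sums). $\Psi$ is the isomorphism determined linearly by $\Psi(\mathfrak{b}^l_{i,k})={\rm B}^l_{i,k}$. A first integral (invariant)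 of $v$ is a function $f$ with $v(f)=0$; two first integrals are functionally independent if their gradients have rank $2$ almost everywhere. $\langle f,g\rangle$ denotes the ring generated by $f$ and $g$. Clebsch potentials of a vector field are first integrals whose gradients' cross product represents it.
   Formalization: In (2) the cross product is taken in the opposite order, B = Δ^k(∇Δ × ∇b), and likewise v = ∇Δ × ∇Ψ^{-1}(v), because the printed order gives −B (e.g. l=−1, i=k=0 gives −M instead of M). *)

theory Defs
  imports "HOL-Analysis.Analysis" "HOL-Computational_Algebra.Formal_Power_Series"
begin

instantiation fps :: (real_vector) real_vector
begin

definition scaleR_fps_def: "scaleR r f = Abs_fps (\<lambda>n. scaleR r (fps_nth f n))"

instance
  by standard (simp_all add: scaleR_fps_def fps_eq_iff algebra_simps)

end

text \<open>
  The ring of formal power series in the coordinates x, y, z is rendered as iterated univariate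
  power series, x being the outermost variable.  Polynomials are the series with finite support.
\<close>

type_synonym series = "real fps fps fps"
type_synonym vfield = "series ^ 3"

definition coef :: "series \<Rightarrow> nat \<times> nat \<times> nat \<Rightarrow> real" where
  "coef f = (\<lambda>(a, b, c). fps_nth (fps_nth (fps_nth f a) b) c)"

definition X :: series where "X = fps_X"
definition Y :: series where "Y = fps_const fps_X"
definition Z :: series where "Z = fps_const (fps_const fps_X)"

definition \<Delta> :: series where "\<Delta> = X * Z - Y\<^sup>2"

definition dx :: "series \<Rightarrow> series" where "dx f = fps_deriv f"
definition dy :: "series \<Rightarrow> series" where "dy f = Abs_fps (\<lambda>a. fps_deriv (fps_nth f a))"
definition dz :: "series \<Rightarrow> series" where
  "dz f = Abs_fps (\<lambda>a. Abs_fps (\<lambda>b. fps_deriv (fps_nth (fps_nth f a) b)))"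

definition gradient :: "series \<Rightarrow> vfield" where
  "gradient f = vector [dx f, dy f, dz f]"

text \<open>The formula of the library constant \<open>cross3\<close>, which is restricted to real vectors.\<close>

definition vf_cross :: "vfield \<Rightarrow> vfield \<Rightarrow> vfield" (infixr "\<times>\<^sub>v" 80) where
  "v \<times>\<^sub>v w = vector [v$2 * w$3 - v$3 * w$2,
                    v$3 * w$1 - v$1 * w$3,
                    v$1 * w$2 - v$2 * w$1]"

definition vf_apply :: "vfield \<Rightarrow> series \<Rightarrow> series" where
  "vf_apply v f = v$1 * dx f + v$2 * dy f + v$3 * dz f"

text \<open>
  The triple of the derivation \<open>vw - wv\<close>: the components of a derivation are its values at
  the coordinates.
\<close>

definition lie_bracket :: "vfield \<Rightarrow> vfield \<Rightarrow> vfield" where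
  "lie_bracket v w =
    (let D = (\<lambda>f. vf_apply v (vf_apply w f) - vf_apply w (vf_apply v f)) in vector [D X, D Y, D Z])"

definition ad :: "vfield \<Rightarrow> vfield \<Rightarrow> vfield" where "ad v w = lie_bracket v w"

definition N :: vfield where "N = vector [0, X, 2 * Y]"
definition M :: vfield where "M = vector [2 * Y, Z, 0]"

definition kappa :: "nat \<Rightarrow> nat \<Rightarrow> real" where
  "kappa l m = fact m / fact (m - l)"

text \<open>
  The upper index \<open>l \<ge> -1\<close> is an integer, so the exponent \<open>l + 1\<close> is \<open>nat (l + 1)\<close>.
\<close>

definition B :: "int \<Rightarrow> nat \<Rightarrow> nat \<Rightarrow> vfield" where
  "B l i k = (1 / kappa (nat (l + 1)) (2 * i + 2)) *\<^sub>R
     (ad N ^^ nat (l + 1)) ((Z ^ i * \<Delta> ^ k) *s M)"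

definition \<bb> :: "int \<Rightarrow> nat \<Rightarrow> nat \<Rightarrow> series" where
  "\<bb> l i k = - (1 / (real (i + 1) * kappa (nat (l + 1)) (2 * i + 2))) *\<^sub>R
     (vf_apply N ^^ nat (l + 1)) (Z ^ (i + 1) * \<Delta> ^ k)"

text \<open>
  Formal sums are taken coefficientwise.  The series \<open>\<bb> l i k\<close> and the components of
  \<open>B l i k\<close> are homogeneous of degree \<open>i + 2 k + 1\<close>, so for the families used below every
  coefficient is nonzero at only finitely many indices.
\<close>

definition formal_sum :: "('s \<Rightarrow> series) \<Rightarrow> 's set \<Rightarrow> series" where
  "formal_sum F S = Abs_fps (\<lambda>a. Abs_fps (\<lambda>b. Abs_fps (\<lambda>c.
     \<Sum>s | s \<in> S \<and> coef (F s) (a, b, c) \<noteq> 0. coef (F s) (a, b, c))))"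

definition formal_sum_vf :: "('s \<Rightarrow> vfield) \<Rightarrow> 's set \<Rightarrow> vfield" where
  "formal_sum_vf F S = (\<chi> j. formal_sum (\<lambda>s. F s $ j) S)"

definition indices :: "(int \<times> nat \<times> nat) set" where
  "indices = {(l, i, k). -1 \<le> l \<and> l \<le> 2 * int i + 1}"

definition sum_\<bb> :: "(int \<times> nat \<times> nat \<Rightarrow> real) \<Rightarrow> (int \<times> nat \<times> nat) set \<Rightarrow> series" where
  "sum_\<bb> \<beta> S = formal_sum (\<lambda>(l, i, k). \<beta> (l, i, k) *\<^sub>R \<bb> l i k) S"

definition sum_B :: "(int \<times> nat \<times> nat \<Rightarrow> real) \<Rightarrow> (int \<times> nat \<times> nat) set \<Rightarrow> vfield" where
  "sum_B \<beta> S = formal_sum_vf (\<lambda>(l, i, k). \<beta> (l, i, k) *\<^sub>R B l i k) S"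

definition \<B> :: "vfield set" where
  "\<B> = span {B 1 0 0 + sum_B \<beta> {(l, i, k) \<in> indices. i \<ge> 1} | \<beta>. True}"

definition \<BB> :: "series set" where
  "\<BB> = span {\<bb> 1 0 0 + sum_\<bb> \<beta> indices | \<beta>. True}"

text \<open>
  The formally linear map on \<open>\<BB>\<close> with \<open>\<Psi> (\<bb> l i k) = B l i k\<close>.  The family \<open>B\<close> in the
  description of \<open>\<B>\<close> starts at \<open>i = 1\<close> apart from its leading term, so \<open>\<B>\<close> is in general
  only a subset of the image of \<open>\<Psi>\<close>.
\<close>

definition \<Psi> :: "series \<Rightarrow> vfield" where
  "\<Psi> w = (THE v. \<exists>\<beta>. w = sum_\<bb> \<beta> indices \<and> v = sum_B \<beta> indices)"

definition \<Psi>_inv :: "vfield \<Rightarrow> series" where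
  "\<Psi>_inv = inv_into \<BB> \<Psi>"

definition first_integral :: "vfield \<Rightarrow> series \<Rightarrow> bool" where
  "first_integral v f \<longleftrightarrow> vf_apply v f = 0"

definition invariants :: "vfield \<Rightarrow> series set" where
  "invariants v = {f. first_integral v f}"

definition clebsch_potentials :: "vfield \<Rightarrow> series \<Rightarrow> series \<Rightarrow> bool" where
  "clebsch_potentials v f g \<longleftrightarrow>
     first_integral v f \<and> first_integral v g \<and> v = gradient f \<times>\<^sub>v gradient g"

text \<open>The ring generated over the real constants.\<close>

inductive_set generated_ring :: "series set \<Rightarrow> series set" for S where
  const: "c *\<^sub>R 1 \<in> generated_ring S"
| gen: "f \<in> S \<Longrightarrow> f \<in> generated_ring S"
| diff: "f \<in> generated_ring S \<Longrightarrow> g \<in> generated_ring S \<Longrightarrow> f - g \<in> generated_ring S"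
| mult: "f \<in> generated_ring S \<Longrightarrow> g \<in> generated_ring S \<Longrightarrow> f * g \<in> generated_ring S"

definition support :: "series \<Rightarrow> (nat \<times> nat \<times> nat) set" where
  "support f = {m. coef f m \<noteq> 0}"

definition is_polynomial :: "series \<Rightarrow> bool" where
  "is_polynomial f \<longleftrightarrow> finite (support f)"

definition poly_fun :: "series \<Rightarrow> real ^ 3 \<Rightarrow> real" where
  "poly_fun f p = (\<Sum>(a, b, c) \<in> support f. coef f (a, b, c) * (p$1) ^ a * (p$2) ^ b * (p$3) ^ c)"

definition fun_gradient :: "(real ^ 3 \<Rightarrow> real) \<Rightarrow> real ^ 3 \<Rightarrow> real ^ 3" where
  "fun_gradient F p = (\<chi> j. frechet_derivative F (at p) (axis j 1))"

definition functionally_independent :: "(real ^ 3 \<Rightarrow> real) \<Rightarrow> (real ^ 3 \<Rightarrow> real) \<Rightarrow> bool" where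
  "functionally_independent F G \<longleftrightarrow>
     (\<forall>p. F differentiable (at p)) \<and> (\<forall>p. G differentiable (at p)) \<and>
     (AE p in lborel. rank (vector [fun_gradient F p, fun_gradient G p] :: real ^ 3 ^ 2) = 2)"

text \<open>
  With these signs one has \<open>B l i k = \<Delta>\<^sup>k (\<nabla>\<Delta> \<times> \<nabla>(\<bb> l i 0))\<close>.  The opposite order of the
  factors is off by a sign, already for the lowest indices:
\<close>

lemma gradient_order: "B (-1) 0 0 \<noteq> \<Delta> ^ 0 *s (gradient (\<bb> (-1) 0 0) \<times>\<^sub>v gradient \<Delta>)"
proof -
  have scale: "r *\<^sub>R f = fps_const (fps_const (fps_const r)) * f" for r and f :: series
    by (simp add: scaleR_fps_def fps_eq_iff)
  have b: "\<bb> (-1) 0 0 = - Z"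
    by (simp add: \<bb>_def kappa_def scale flip: fps_const_neg)
  have "gradient \<Delta> $ 1 = Z"
    by (simp add: gradient_def dx_def \<Delta>_def X_def Y_def Z_def power2_eq_square)
  moreover have "gradient (- Z) $ 1 = 0" "gradient (- Z) $ 3 = - 1"
    by (auto simp: gradient_def dx_def dz_def Z_def fps_eq_iff)
  ultimately have "(gradient (\<bb> (-1) 0 0) \<times>\<^sub>v gradient \<Delta>) $ 2 = - Z"
    unfolding b by (simp add: vf_cross_def)
  moreover have "B (-1) 0 0 $ 2 = Z"
    by (simp add: B_def M_def kappa_def)
  moreover have "Z \<noteq> - Z"
  proof
    assume "Z = - Z"
    then have "coef Z (0, 0, 1) = coef (- Z) (0, 0, 1)" by simp
    then show False by (simp add: coef_def Z_def)
  qed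
  ultimately show ?thesis by (metis power_0 vector_smult_lid)
qed

end

theory Submission
  imports Defs
begin

text \<open>
  Put \<open>ham f = \<nabla>\<Delta> \<times> \<nabla>f\<close>.  Both \<open>f\<close> and \<open>\<Delta>\<close> are first integrals of \<open>ham f\<close>, and since \<open>N\<close> is itself
  \<open>ham X\<close>, the Jacobi identity gives \<open>ad N (ham f) = ham (N f)\<close>.  Hence \<open>B l i k = ham (\<bb> l i k)\<close>, and
  \<open>ham\<close> passes through the degreewise finite formal sums, so that \<open>\<Psi>\<close> is the restriction of \<open>ham\<close>.
  For functional independence, the outer components of \<open>ham f\<close> are \<open>- N f\<close> and \<open>M f\<close>, and the
  \<open>sl\<^sub>2\<close> relation \<open>M N\<^bsup>j+1\<^esup> z\<^bsup>n\<^esup> = (j + 1) (2 n - j) N\<^bsup>j\<^esup> z\<^bsup>n\<^esup>\<close> shows that for \<open>f = \<bb> l i 0\<close> one of them is a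
  nonzero multiple of some \<open>N\<^bsup>j\<^esup> z\<^bsup>n\<^esup>\<close> with \<open>j \<le> 2 n\<close>.  This polynomial has nonnegative coefficients, so it
  is positive at \<open>(1, 1, 1)\<close>, and the zero set of a nonzero homogeneous polynomial function is null.
\<close>

section \<open>Coefficients and partial derivatives\<close>

text \<open>Applied at each of the three levels of nesting, this makes \<open>series\<close> a real
  algebra, so that scalars move freely through products.\<close>

instance fps :: (real_algebra) real_algebra
  by standard
    (simp_all add: fps_eq_iff scaleR_fps_def fps_mult_nth scaleR_sum_right)

lemma coef_scaleR [simp]: "coef (r *\<^sub>R f) m = r * coef f m"
  by (simp add: coef_def scaleR_fps_def split: prod.split)

lemma coef_0 [simp]: "coef 0 m = 0"
  by (simp add: coef_def split: prod.split)

lemma coef_add [simp]: "coef (f + g) m = coef f m + coef g m"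
  by (simp add: coef_def split: prod.split)

lemma coef_diff [simp]: "coef (f - g) m = coef f m - coef g m"
  by (simp add: coef_def split: prod.split)

lemma coef_uminus [simp]: "coef (- f) m = - coef f m"
  by (simp add: coef_def split: prod.split)

lemma coef_sum: "coef (sum F T) m = (\<Sum>s\<in>T. coef (F s) m)"
  by (induction T rule: infinite_finite_induct) auto

lemma series_eqI: "(\<And>a b c. coef f (a, b, c) = coef g (a, b, c)) \<Longrightarrow> f = g"
  by (simp add: coef_def fps_eq_iff)

lemma coef_1: "coef 1 (a, b, c) = (if a = 0 \<and> b = 0 \<and> c = 0 then 1 else 0)"
  by (simp add: coef_def)

lemma coef_X_mult: "coef (X * f) (a, b, c) = (if a = 0 then 0 else coef f (a - 1, b, c))"
  by (simp add: coef_def X_def)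

lemma coef_Y_mult: "coef (Y * f) (a, b, c) = (if b = 0 then 0 else coef f (a, b - 1, c))"
  by (simp add: coef_def Y_def)

lemma coef_Z_mult: "coef (Z * f) (a, b, c) = (if c = 0 then 0 else coef f (a, b, c - 1))"
  by (simp add: coef_def Z_def)

lemma coef_numeral_mult: "coef (numeral n * f) m = numeral n * coef f m"
proof -
  have "numeral n * f = of_nat (numeral n) * f" by simp
  then show ?thesis
    by (simp only: coef_def fps_mult_of_nat_nth split: prod.split) simp
qed

lemma scaleR_2_eq: "2 * f = 2 *\<^sub>R (f :: series)"
  by (simp only: scaleR_2 mult_2)

lemma coef_dx [simp]: "coef (dx f) (a, b, c) = real (Suc a) * coef f (Suc a, b, c)"
  by (simp add: coef_def dx_def fps_mult_of_nat_nth del: of_nat_Suc)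

lemma coef_dy [simp]: "coef (dy f) (a, b, c) = real (Suc b) * coef f (a, Suc b, c)"
  by (simp add: coef_def dy_def fps_mult_of_nat_nth del: of_nat_Suc)

lemma coef_dz [simp]: "coef (dz f) (a, b, c) = real (Suc c) * coef f (a, b, Suc c)"
  by (simp add: coef_def dz_def del: of_nat_Suc)

lemma linear_dx: "linear dx" and linear_dy: "linear dy" and linear_dz: "linear dz"
  by (auto intro!: linearI series_eqI simp: algebra_simps)

lemmas d_linear [simp] =
  linear_add [OF linear_dx] linear_add [OF linear_dy] linear_add [OF linear_dz]
  linear_diff [OF linear_dx] linear_diff [OF linear_dy] linear_diff [OF linear_dz]
  linear_neg [OF linear_dx] linear_neg [OF linear_dy] linear_neg [OF linear_dz]
  linear_0 [OF linear_dx] linear_0 [OF linear_dy] linear_0 [OF linear_dz]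
  linear_cmul [OF linear_dx] linear_cmul [OF linear_dy] linear_cmul [OF linear_dz]

lemma d_commute: "dy (dx f) = dx (dy f)" "dz (dx f) = dx (dz f)" "dz (dy f) = dy (dz f)"
  by (auto intro!: series_eqI)

text \<open>A coefficient of a product is a finite sum of products, so a derivation of the
  coefficient ring, applied to each coefficient, is again a derivation. One use gives the Leibniz
  rule of \<open>dy\<close>, two nested uses that of \<open>dz\<close>.\<close>

lemma coefficientwise_derivation:
  fixes f g :: "'a::comm_ring_1 fps"
  assumes D_add: "\<And>a b. D (a + b) = D a + D b"
    and D_mult: "\<And>a b. D (a * b) = a * D b + D a * b"
  shows "Abs_fps (\<lambda>n. D (fps_nth (f * g) n)) =
    f * Abs_fps (\<lambda>n. D (fps_nth g n)) + Abs_fps (\<lambda>n. D (fps_nth f n)) * g"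
proof -
  have D_0: "D 0 = 0" using D_add[of 0 0] by simp
  have D_sum: "D (sum h T) = (\<Sum>t\<in>T. D (h t))" for h :: "nat \<Rightarrow> 'a" and T
    by (induction T rule: infinite_finite_induct) (auto simp: D_0 D_add)
  show ?thesis
    by (simp add: fps_eq_iff fps_mult_nth D_sum D_mult sum.distrib)
qed

lemma dx_mult [simp]: "dx (f * g) = f * dx g + dx f * g"
  by (simp add: dx_def)

lemma dy_mult [simp]: "dy (f * g) = f * dy g + dy f * g"
  unfolding dy_def by (rule coefficientwise_derivation) simp_all

lemma dz_mult [simp]: "dz (f * g) = f * dz g + dz f * g"
  unfolding dz_def
  by (rule coefficientwise_derivation; (rule coefficientwise_derivation)?)
    (simp_all add: fps_eq_iff algebra_simps)

lemma d_coordinates [simp]: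
  "dx X = 1" "dy X = 0" "dz X = 0"
  "dx Y = 0" "dy Y = 1" "dz Y = 0"
  "dx Z = 0" "dy Z = 0" "dz Z = 1"
  by (simp_all add: dx_def dy_def dz_def X_def Y_def Z_def fps_eq_iff fps_X_def)

lemma d_numeral [simp]: "dx (numeral n) = 0" "dy (numeral n) = 0" "dz (numeral n) = 0"
  and d_one [simp]: "dx 1 = 0" "dy 1 = 0" "dz 1 = 0"
proof -
  show one: "dx 1 = 0" "dy 1 = 0" "dz 1 = 0"
    by (auto intro!: series_eqI simp: coef_1)
  have "coef (numeral n) m = numeral n * coef 1 m" for m
    using coef_numeral_mult[of n 1 m] by simp
  then show "dx (numeral n) = 0" "dy (numeral n) = 0" "dz (numeral n) = 0"
    by (auto intro!: series_eqI simp: coef_1)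
qed

lemma d_Delta [simp]: "dx \<Delta> = Z" "dy \<Delta> = - 2 * Y" "dz \<Delta> = X"
  by (simp_all add: \<Delta>_def power2_eq_square)

section \<open>Hamiltonian vector fields\<close>

lemma vf_apply_N: "vf_apply N f = X * dy f + 2 * Y * dz f"
  by (simp add: vf_apply_def N_def)

lemma vf_apply_M: "vf_apply M f = 2 * Y * dx f + Z * dy f"
  by (simp add: vf_apply_def M_def)

lemma linear_vf_apply: "linear (vf_apply v)"
  by (auto intro!: linearI simp: vf_apply_def algebra_simps)

lemma vf_apply_mult: "vf_apply v (f * g) = f * vf_apply v g + vf_apply v f * g"
  by (simp add: vf_apply_def algebra_simps)

lemma vf_apply_smult: "vf_apply (h *s v) f = h * vf_apply v f"
  by (simp add: vf_apply_def algebra_simps)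

lemma vf_apply_scaleR: "vf_apply (r *\<^sub>R v) f = r *\<^sub>R vf_apply v f"
  by (simp add: vf_apply_def algebra_simps)

text \<open>The Hamiltonian vector field of \<open>f\<close> for the Poisson structure with Casimir \<open>\<Delta>\<close>.\<close>

definition ham :: "series \<Rightarrow> vfield" where
  "ham f = gradient \<Delta> \<times>\<^sub>v gradient f"

text \<open>Up to sign the components are the operators of an sl2 triple acting on \<open>f\<close>;
  the middle one multiplies the monomial x^a y^b z^c by a - c.\<close>

lemma ham_nth:
  "ham f $ 1 = - vf_apply N f"
  "ham f $ 2 = X * dx f - Z * dz f"
  "ham f $ 3 = vf_apply M f"
  by (simp_all add: ham_def vf_cross_def gradient_def vf_apply_N vf_apply_M)

lemma linear_ham: "linear ham"
  by (auto intro!: linearI simp: vec_eq_iff forall_3 ham_nth linear_add[OF linear_vf_apply]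
      linear_cmul[OF linear_vf_apply] algebra_simps)

text \<open>A triple product with a repeated factor vanishes; \<open>ham_Delta\<close> holds for the
  same reason.\<close>

lemma ham_self: "vf_apply (ham f) f = 0"
  unfolding vf_apply_def[of "ham f"] ham_nth vf_apply_N vf_apply_M by (simp add: algebra_simps)

lemma ham_Delta: "vf_apply (ham f) \<Delta> = 0"
  unfolding vf_apply_def[of "ham f"] ham_nth vf_apply_N vf_apply_M by (simp add: algebra_simps)

lemma ham_coordinates:
  "vf_apply (ham f) X = - vf_apply N f"
  "vf_apply (ham f) Y = X * dx f - Z * dz f"
  "vf_apply (ham f) Z = vf_apply M f"
  by (simp_all add: vf_apply_def[of "ham f"] ham_nth)

text \<open>Verified on the coordinates, where \<open>N\<close> takes the values \<open>0\<close>,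
  \<open>X\<close> and \<open>2 * Y\<close>: the three equations are the commutation relations of
  \<open>N\<close> with itself, with the weight operator and with \<open>M\<close>.\<close>

lemma ad_N_ham: "ad N (ham f) = ham (vf_apply N f)"
  unfolding ad_def lie_bracket_def Let_def vec_eq_iff forall_3 vector_3 ham_coordinates ham_nth
  unfolding vf_apply_N vf_apply_M
  by (simp add: d_commute algebra_simps) (simp add: vf_apply_def ham_nth N_def M_def algebra_simps)

lemma vf_apply_Delta_mult:
  assumes "vf_apply v \<Delta> = 0"
  shows "vf_apply v (\<Delta> ^ k * f) = \<Delta> ^ k * vf_apply v f"
  by (induction k) (simp_all add: vf_apply_mult assms mult.assoc)

lemma N_Delta [simp]: "vf_apply N \<Delta> = 0"
  by (simp add: vf_apply_N algebra_simps)

lemma M_Delta [simp]: "vf_apply M \<Delta> = 0"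
  by (simp add: vf_apply_M algebra_simps)

text \<open>The extra Leibniz term contains the gradient of \<Delta>, whose cross product with
  itself vanishes; powers of \<Delta> thus act like scalars.\<close>

lemma ham_Delta_mult: "ham (\<Delta> ^ k * f) = \<Delta> ^ k *s ham f"
proof (induction k)
  case (Suc k)
  have "ham (\<Delta> * g) = \<Delta> *s ham g" for g
    by (simp add: vec_eq_iff forall_3 ham_nth vf_apply_mult algebra_simps)
  with Suc show ?case by (simp add: mult.assoc vector_smult_assoc)
qed simp

lemma N_pow_Delta_mult:
  "(vf_apply N ^^ j) (\<Delta> ^ k * f) = \<Delta> ^ k * (vf_apply N ^^ j) f"
  by (induction j) (simp_all add: vf_apply_Delta_mult)

lemma N_pow_scaleR: "(vf_apply N ^^ j) (r *\<^sub>R f) = r *\<^sub>R (vf_apply N ^^ j) f"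
  by (induction j) (simp_all add: linear_cmul[OF linear_vf_apply])

lemma ad_N_pow_ham: "(ad N ^^ j) (ham f) = ham ((vf_apply N ^^ j) f)"
  by (induction j) (simp_all add: ad_N_ham)

text \<open>Since \<open>ham Z = - M\<close>, this accounts for the factor
  \<open>- 1 / (i + 1)\<close> in \<open>\<bb>\<close>. For \<open>n = 0\<close> the truncated
  exponent is harmless, because the factor \<open>real n\<close> vanishes.\<close>

lemma ham_Z_pow: "ham (Z ^ n) = - (real n *\<^sub>R Z ^ (n - 1)) *s M"
proof (cases n)
  case (Suc m)
  have "dx (Z ^ k) = 0" "dy (Z ^ k) = 0" for k by (induction k) simp_all
  moreover have "dz (Z ^ Suc k) = real (Suc k) *\<^sub>R Z ^ k" for k
    by (induction k) (simp_all add: algebra_simps scaleR_2 mult_2_right)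
  ultimately show ?thesis
    unfolding Suc vec_eq_iff forall_3 ham_nth vf_apply_N vf_apply_M
    by (simp add: M_def algebra_simps del: power_Suc)
qed (simp add: vec_eq_iff forall_3 ham_nth vf_apply_N vf_apply_M)

lemma b_eq: "\<bb> l i k = \<Delta> ^ k * \<bb> l i 0"
  unfolding \<bb>_def by (simp add: mult.commute[of _ "\<Delta> ^ k"] N_pow_Delta_mult)

lemma B_eq_ham: "B l i k = ham (\<bb> l i k)"
proof -
  let ?n = "real (i + 1)"
  \<comment> \<open>The seed of the family is Hamiltonian; \<open>ad_N_pow_ham\<close> then carries
    this along the powers of \<open>ad N\<close>, and both sides share the factor
    \<open>kappa\<close>.\<close>
  have eq: "(Z ^ i * \<Delta> ^ k) *s M = ham (- (1 / ?n) *\<^sub>R (Z ^ (i + 1) * \<Delta> ^ k))"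
    unfolding linear_cmul[OF linear_ham] mult.commute[of _ "\<Delta> ^ k"] ham_Delta_mult ham_Z_pow
    by (simp add: vec_eq_iff del: of_nat_add of_nat_Suc)
  show ?thesis
    unfolding B_def \<bb>_def eq
    unfolding ad_N_pow_ham N_pow_scaleR
    unfolding linear_cmul[OF linear_ham]
    by (simp add: mult.commute del: of_nat_add of_nat_Suc)
qed

section \<open>Degree and weight\<close>

text \<open>A joint eigenspace of the Euler operator and of the weight operator z d/dz - x d/dx; the
  zero series belongs to all of them.\<close>

definition graded :: "nat \<Rightarrow> int \<Rightarrow> series \<Rightarrow> bool" where
  "graded d w f \<longleftrightarrow> (\<forall>a b c. coef f (a, b, c) \<noteq> 0 \<longrightarrow> a + b + c = d \<and> int c - int a = w)"

lemma coef_N: "coef (vf_apply N f) (a, b, c) =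
    (if a = 0 then 0 else real (Suc b) * coef f (a - 1, Suc b, c)) +
    2 * (if b = 0 then 0 else real (Suc c) * coef f (a, b - 1, Suc c))"
  by (simp add: vf_apply_N coef_X_mult coef_Y_mult coef_numeral_mult mult.assoc)

lemma coef_M: "coef (vf_apply M f) (a, b, c) =
    2 * (if b = 0 then 0 else real (Suc a) * coef f (Suc a, b - 1, c)) +
    (if c = 0 then 0 else real (Suc b) * coef f (a, Suc b, c - 1))"
  by (simp add: vf_apply_M coef_Z_mult coef_Y_mult coef_numeral_mult mult.assoc)

lemma coef_weight: "coef (X * dx f - Z * dz f) (a, b, c) = (real a - real c) * coef f (a, b, c)"
  by (simp add: coef_X_mult coef_Z_mult algebra_simps)

text \<open>Each term of \<open>N\<close> trades a factor y for an x or a z for a y, which costs one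
  unit of weight and keeps the degree.\<close>

lemma graded_N:
  assumes "graded d w f"
  shows "graded d (w - 1) (vf_apply N f)"
  unfolding graded_def
proof (intro allI impI)
  fix a b c assume "coef (vf_apply N f) (a, b, c) \<noteq> 0"
  then consider "a \<noteq> 0" "coef f (a - 1, Suc b, c) \<noteq> 0" | "b \<noteq> 0" "coef f (a, b - 1, Suc c) \<noteq> 0"
    unfolding coef_N
    by (cases "a = 0 \<or> coef f (a - 1, Suc b, c) = 0") (auto split: if_splits)
  then show "a + b + c = d \<and> int c - int a = w - 1"
    using assms unfolding graded_def by cases fastforce+
qed

lemma graded_Z_pow: "graded n (int n) (Z ^ n)"
proof (induction n)
  case (Suc n)
  then show ?case
    unfolding graded_def power_Suc coef_Z_mult by (fastforce split: if_splits)
qed (simp add: graded_def coef_1)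

lemma coef_Delta_mult: "coef (\<Delta> * f) (a, b, c) =
    (if a = 0 \<or> c = 0 then 0 else coef f (a - 1, b, c - 1)) -
    (if b < 2 then 0 else coef f (a, b - 2, c))"
proof -
  have "\<Delta> * f = X * (Z * f) - Y * (Y * f)"
    by (simp add: \<Delta>_def algebra_simps power2_eq_square)
  then show ?thesis
    by (auto simp add: coef_X_mult coef_Y_mult coef_Z_mult numeral_2_eq_2)
qed

text \<open>Both monomials of \<Delta> have degree 2 and weight 0.\<close>

lemma graded_Delta_pow_mult:
  assumes "graded d w f"
  shows "graded (d + 2 * k) w (\<Delta> ^ k * f)"
proof (induction k)
  case (Suc k)
  then show ?case
    unfolding graded_def
  proof (intro allI impI)
    fix a b c assume "coef (\<Delta> ^ Suc k * f) (a, b, c) \<noteq> 0"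
    then consider "a \<noteq> 0" "c \<noteq> 0" "coef (\<Delta> ^ k * f) (a - 1, b, c - 1) \<noteq> 0"
      | "b \<ge> 2" "coef (\<Delta> ^ k * f) (a, b - 2, c) \<noteq> 0"
      unfolding power_Suc mult.assoc coef_Delta_mult
      by (cases "b < 2 \<or> coef (\<Delta> ^ k * f) (a, b - 2, c) = 0") (auto split: if_splits)
    then show "a + b + c = d + 2 * Suc k \<and> int c - int a = w"
      using Suc unfolding graded_def by cases fastforce+
  qed
qed (simp add: assms)

lemma graded_N_pow: "graded n (int n - int j) ((vf_apply N ^^ j) (Z ^ n))"
proof (induction j)
  case (Suc j)
  from graded_N [OF this] show ?case by (simp add: algebra_simps)
qed (simp add: graded_Z_pow)

lemma graded_scaleR: "graded d w f \<Longrightarrow> graded d w (r *\<^sub>R f)"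
  by (auto simp: graded_def)

lemma graded_b:
  assumes "-1 \<le> l"
  shows "graded (i + 2 * k + 1) (int i - l) (\<bb> l i k)"
proof -
  have "graded (i + 1) (int i - l) (\<bb> l i 0)"
    unfolding \<bb>_def using graded_N_pow[of "i + 1" "nat (l + 1)"] assms
    by (intro graded_scaleR) simp
  from graded_Delta_pow_mult[OF this] show ?thesis
    by (subst b_eq) (simp add: algebra_simps)
qed

section \<open>The sl2 string of \<open>Z ^ n\<close>\<close>

lemma M_N: "vf_apply M (vf_apply N f) = vf_apply N (vf_apply M f) - 2 * (X * dx f - Z * dz f)"
  unfolding vf_apply_N vf_apply_M by (simp add: d_commute algebra_simps)

lemma graded_weight:
  assumes "graded d w f"
  shows "X * dx f - Z * dz f = - real_of_int w *\<^sub>R f"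
proof (rule series_eqI)
  fix a b c
  show "coef (X * dx f - Z * dz f) (a, b, c) = coef (- real_of_int w *\<^sub>R f) (a, b, c)"
  proof (cases "coef f (a, b, c) = 0")
    case False
    with assms have "w = int c - int a" by (auto simp: graded_def)
    then have "real a - real c = - real_of_int w" by simp
    then show ?thesis unfolding coef_weight by simp
  qed (simp add: coef_weight del: coef_diff)
qed

text \<open>\<open>Z ^ n\<close> is a highest weight vector, annihilated by \<open>M\<close>. Moving
  \<open>M\<close> past each further \<open>N\<close> adds twice the current weight, and the sum of
  2 (n - m) over m = 0, ..., j is (j + 1) (2 n - j).\<close>

lemma M_N_pow:
  "vf_apply M ((vf_apply N ^^ Suc j) (Z ^ n)) =
     (real (Suc j) * (2 * real n - real j)) *\<^sub>R (vf_apply N ^^ j) (Z ^ n)"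
proof (induction j)
  case 0
  have "vf_apply M (Z ^ n) = 0"
    by (induction n) (simp_all add: vf_apply_mult vf_apply_M)
  then show ?case
    by (simp add: M_N linear_0[OF linear_vf_apply] graded_weight[OF graded_Z_pow] scaleR_2_eq)
next
  case (Suc j)
  let ?g = "(vf_apply N ^^ Suc j) (Z ^ n)"
  have "vf_apply M (vf_apply N ?g) =
      vf_apply N ((real (Suc j) * (2 * real n - real j)) *\<^sub>R (vf_apply N ^^ j) (Z ^ n)) -
      2 *\<^sub>R (- real_of_int (int n - int (Suc j)) *\<^sub>R ?g)"
    by (simp only: M_N Suc.IH graded_weight[OF graded_N_pow] scaleR_2_eq)
  also have "\<dots> = (real (Suc j) * (2 * real n - real j)) *\<^sub>R ?g +
      (2 * (real n - real (Suc j))) *\<^sub>R ?g"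
    by (simp only: linear_cmul[OF linear_vf_apply] of_int_diff of_int_of_nat_eq funpow.simps o_apply
        scaleR_minus_left scaleR_minus_right diff_minus_eq_add scaleR_scaleR)
  also have "\<dots> = (real (Suc (Suc j)) * (2 * real n - real (Suc j))) *\<^sub>R ?g"
    unfolding scaleR_add_left[symmetric]
    by (rule arg_cong[where f = "\<lambda>r. r *\<^sub>R ?g"]) (simp add: algebra_simps)
  finally show ?case by (simp only: funpow.simps o_apply)
qed

lemma N_pow_nonzero: "j \<le> 2 * n \<Longrightarrow> (vf_apply N ^^ j) (Z ^ n) \<noteq> 0"
proof (induction j)
  case 0
  have "coef Z (0, 0, 1) \<noteq> 0" by (simp add: coef_def Z_def)
  then have "Z \<noteq> 0" by auto
  then show ?case by simp
next
  case (Suc j)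
  \<comment> \<open>The factor (j + 1) (2 n - j) is nonzero as j < 2 n, so \<open>M\<close> returns
    a nonzero multiple of the previous term.\<close>
  then have "vf_apply M ((vf_apply N ^^ Suc j) (Z ^ n)) \<noteq> 0"
    unfolding M_N_pow by simp
  then show ?case by (metis linear_0[OF linear_vf_apply])
qed

lemma N_pow_nonneg: "0 \<le> coef ((vf_apply N ^^ j) (Z ^ n)) m"
proof (induction j arbitrary: m)
  case 0
  show ?case
  proof (induction n arbitrary: m)
    case 0
    show ?case by (cases m) (simp add: coef_1)
  next
    case (Suc n)
    then show ?case by (cases m) (simp add: coef_Z_mult)
  qed
next
  case (Suc j)
  then show ?case by (cases m) (simp add: coef_N)
qed

text \<open>The weight \<open>- n - 1\<close> does not occur in degree \<open>n\<close>.\<close>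

lemma N_pow_eq_0: "(vf_apply N ^^ (2 * n + 1)) (Z ^ n) = 0"
proof (rule series_eqI)
  fix a b c
  show "coef ((vf_apply N ^^ (2 * n + 1)) (Z ^ n)) (a, b, c) = coef 0 (a, b, c)"
    using graded_N_pow[of n "2 * n + 1"] by (force simp: graded_def)
qed

text \<open>All components of \<open>ham\<close> are first-order operators with linear coefficients
  and hence preserve the degree. This reduces infinite formal sums to their finite parts of a single
  degree.\<close>

lemma ham_local:
  assumes "\<And>a b c. a + b + c = d \<Longrightarrow> coef f (a, b, c) = coef g (a, b, c)"
    and "a + b + c = d"
  shows "coef (ham f $ j) (a, b, c) = coef (ham g $ j) (a, b, c)"
proof -
  have "coef f (a, b, c) = coef g (a, b, c)"
    "a \<noteq> 0 \<Longrightarrow> coef f (a - 1, Suc b, c) = coef g (a - 1, Suc b, c)"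
    "b \<noteq> 0 \<Longrightarrow> coef f (a, b - 1, Suc c) = coef g (a, b - 1, Suc c)"
    "b \<noteq> 0 \<Longrightarrow> coef f (Suc a, b - 1, c) = coef g (Suc a, b - 1, c)"
    "c \<noteq> 0 \<Longrightarrow> coef f (a, Suc b, c - 1) = coef g (a, Suc b, c - 1)"
    by (rule assms(1), use assms(2) in simp)+
  then show ?thesis
    using exhaust_3[of j]
    by (elim disjE; cases "b = 0"; cases "c = 0")
      (simp_all add: ham_nth coef_N coef_M coef_weight del: coef_diff)
qed



section \<open>Formal sums\<close>

text \<open>The finite \<open>T\<close> guarantees that only finitely many indices contribute; over
  an infinite set the sum would default to 0.\<close>

lemma coef_formal_sum:
  assumes "finite T" "T \<subseteq> S" "\<And>s. s \<in> S - T \<Longrightarrow> coef (F s) m = 0"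
  shows "coef (formal_sum F S) m = (\<Sum>s\<in>T. coef (F s) m)"
proof -
  have "coef (formal_sum F S) m = (\<Sum>s | s \<in> S \<and> coef (F s) m \<noteq> 0. coef (F s) m)"
    by (cases m) (simp add: coef_def formal_sum_def)
  also have "\<dots> = (\<Sum>s\<in>T. coef (F s) m)"
    using assms by (intro sum.mono_neutral_left) auto
  finally show ?thesis .
qed

definition indices_of_degree :: "nat \<Rightarrow> (int \<times> nat \<times> nat) set" where
  "indices_of_degree d = {(l, i, k) \<in> indices. i + 2 * k + 1 = d}"

lemma finite_indices_of_degree: "finite (indices_of_degree d)"
proof (rule finite_subset)
  show "indices_of_degree d \<subseteq> {-1..2 * int d + 1} \<times> {..d} \<times> {..d}"
    by (auto simp: indices_of_degree_def indices_def)
qed simp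

lemma coef_sum_b:
  assumes "S \<subseteq> indices"
  shows "coef (sum_\<bb> \<beta> S) (a, b, c) =
    (\<Sum>(l, i, k) \<in> S \<inter> indices_of_degree (a + b + c). \<beta> (l, i, k) * coef (\<bb> l i k) (a, b, c))"
  unfolding sum_\<bb>_def
proof (subst coef_formal_sum[where T = "S \<inter> indices_of_degree (a + b + c)"])
  fix s assume "s \<in> S - S \<inter> indices_of_degree (a + b + c)"
  moreover obtain l i k where s: "s = (l, i, k)" by (cases s)
  ultimately have "-1 \<le> l" "i + 2 * k + 1 \<noteq> a + b + c"
    using assms by (auto simp: indices_of_degree_def indices_def)
  then show "coef (case s of (l, i, k) \<Rightarrow> \<beta> (l, i, k) *\<^sub>R \<bb> l i k) (a, b, c) = 0"
    using graded_b[of l i k] by (auto simp: s graded_def)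
qed (auto simp: finite_indices_of_degree intro!: sum.cong)

lemma coef_sum_B:
  assumes "S \<subseteq> indices"
  shows "coef (sum_B \<beta> S $ j) (a, b, c) =
    (\<Sum>(l, i, k) \<in> S \<inter> indices_of_degree (a + b + c). \<beta> (l, i, k) * coef (B l i k $ j) (a, b, c))"
  unfolding sum_B_def formal_sum_vf_def vec_lambda_beta
proof (subst coef_formal_sum[where T = "S \<inter> indices_of_degree (a + b + c)"])
  fix s assume "s \<in> S - S \<inter> indices_of_degree (a + b + c)"
  moreover obtain l i k where s: "s = (l, i, k)" by (cases s)
  ultimately have "-1 \<le> l" "i + 2 * k + 1 \<noteq> a + b + c"
    using assms by (auto simp: indices_of_degree_def indices_def)
  then have "coef (\<bb> l i k) (a', b', c') = 0" if "a' + b' + c' = a + b + c" for a' b' c'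
    using graded_b[of l i k] that unfolding graded_def by metis
  \<comment> \<open>In this degree \<open>\<bb> l i k\<close> agrees with the zero series, so
    \<open>ham_local\<close> compares the two.\<close>
  then have "coef (ham (\<bb> l i k) $ j) (a, b, c) = coef (ham 0 $ j) (a, b, c)"
    by (intro ham_local[OF _ refl]) simp
  then show "coef ((case s of (l, i, k) \<Rightarrow> \<beta> (l, i, k) *\<^sub>R B l i k) $ j) (a, b, c) = 0"
    by (simp add: s B_eq_ham linear_0[OF linear_ham])
qed (auto simp: finite_indices_of_degree intro!: sum.cong)

lemma ham_sum_b:
  assumes "S \<subseteq> indices"
  shows "ham (sum_\<bb> \<beta> S) = sum_B \<beta> S"
  unfolding vec_eq_iff
proof (intro allI series_eqI)
  fix j a b c
  let ?T = "S \<inter> indices_of_degree (a + b + c)"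
  \<comment> \<open>The homogeneous part of degree a + b + c of the formal sum: a finite sum,
    through which \<open>ham\<close> passes by linearity.\<close>
  let ?g = "\<Sum>(l, i, k) \<in> ?T. \<beta> (l, i, k) *\<^sub>R \<bb> l i k"
  have "coef (ham (sum_\<bb> \<beta> S) $ j) (a, b, c) = coef (ham ?g $ j) (a, b, c)"
    by (rule ham_local[OF _ refl])
      (auto simp: coef_sum_b[OF assms] coef_sum intro!: sum.cong)
  also have "\<dots> = coef (sum_B \<beta> S $ j) (a, b, c)"
    by (auto simp: coef_sum_B[OF assms] linear_sum[OF linear_ham] sum_component coef_sum
        linear_cmul[OF linear_ham] B_eq_ham intro!: sum.cong)
  finally show "coef (ham (sum_\<bb> \<beta> S) $ j) (a, b, c) = coef (sum_B \<beta> S $ j) (a, b, c)" .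
qed

text \<open>Extension of the coefficients by zero: the generators of \<B> use only indices with i at
  least 1 in their sums, whereas \<BB> and \<Psi> use all of them.\<close>

lemma sum_b_restrict:
  assumes "S \<subseteq> indices"
  shows "sum_\<bb> \<beta> S = sum_\<bb> (\<lambda>s. if s \<in> S then \<beta> s else 0) indices"
proof (rule series_eqI)
  fix a b c
  show "coef (sum_\<bb> \<beta> S) (a, b, c) =
      coef (sum_\<bb> (\<lambda>s. if s \<in> S then \<beta> s else 0) indices) (a, b, c)"
    unfolding coef_sum_b[OF assms] coef_sum_b[OF subset_refl]
    by (rule sum.mono_neutral_cong_left)
      (use assms in \<open>auto simp: finite_indices_of_degree split: if_splits\<close>)
qed

lemma b_eq_sum_b: "\<bb> l i k = sum_\<bb> (\<lambda>s. 1) {(l, i, k)}"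
proof (rule series_eqI)
  fix a b c
  show "coef (\<bb> l i k) (a, b, c) = coef (sum_\<bb> (\<lambda>s. 1) {(l, i, k)}) (a, b, c)"
    unfolding sum_\<bb>_def by (subst coef_formal_sum[where T = "{(l, i, k)}"]) auto
qed

section \<open>The identification of \<Psi> with \<open>ham\<close>\<close>

lemma subspace_sum_b: "subspace {sum_\<bb> \<beta> indices | \<beta>. True}"
proof (rule subspaceI)
  have "0 = sum_\<bb> (\<lambda>s. 0) indices"
    by (intro series_eqI) (simp add: coef_sum_b case_prod_beta)
  then show "0 \<in> {sum_\<bb> \<beta> indices | \<beta>. True}" by blast
next
  fix u v assume "u \<in> {sum_\<bb> \<beta> indices | \<beta>. True}" "v \<in> {sum_\<bb> \<beta> indices | \<beta>. True}"
  then obtain \<beta> \<gamma> where "u = sum_\<bb> \<beta> indices" "v = sum_\<bb> \<gamma> indices" by blast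
  then have "u + v = sum_\<bb> (\<lambda>s. \<beta> s + \<gamma> s) indices"
    by (intro series_eqI)
      (simp add: coef_sum_b sum.distrib[symmetric] case_prod_beta distrib_right)
  then show "u + v \<in> {sum_\<bb> \<beta> indices | \<beta>. True}" by blast
next
  fix r u assume "u \<in> {sum_\<bb> \<beta> indices | \<beta>. True}"
  then obtain \<beta> where "u = sum_\<bb> \<beta> indices" by blast
  then have "r *\<^sub>R u = sum_\<bb> (\<lambda>s. r * \<beta> s) indices"
    by (intro series_eqI) (simp add: coef_sum_b sum_distrib_left case_prod_beta mult.assoc)
  then show "r *\<^sub>R u \<in> {sum_\<bb> \<beta> indices | \<beta>. True}" by blast
qed

text \<open>The leading term is itself a formal sum over \<open>indices\<close>, so each element of
  \<BB> has the form on which \<Psi> is described.\<close>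

lemma calBB_subset: "\<BB> \<subseteq> {sum_\<bb> \<beta> indices | \<beta>. True}"
  unfolding \<BB>_def
proof (intro span_minimal subspace_sum_b subsetI)
  fix w assume "w \<in> {\<bb> 1 0 0 + sum_\<bb> \<beta> indices | \<beta>. True}"
  then obtain \<beta> where w: "w = \<bb> 1 0 0 + sum_\<bb> \<beta> indices" by blast
  have "{(1, 0, 0)} \<subseteq> indices" by (simp add: indices_def)
  then have "\<bb> 1 0 0 \<in> {sum_\<bb> \<beta> indices | \<beta>. True}"
    unfolding b_eq_sum_b by (subst sum_b_restrict) auto
  then show "w \<in> {sum_\<bb> \<beta> indices | \<beta>. True}"
    unfolding w by (intro subspace_add[OF subspace_sum_b]) auto
qed

text \<open>Every family representing \<open>w\<close> leads to the same vector field
  \<open>ham w\<close>; this settles the uniqueness in the definite description.\<close>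

lemma Psi_eq_ham:
  assumes "w \<in> \<BB>"
  shows "\<Psi> w = ham w"
proof -
  obtain \<beta> where "w = sum_\<bb> \<beta> indices" using assms calBB_subset by blast
  then show ?thesis
    unfolding \<Psi>_def by (intro the_equality) (auto simp flip: ham_sum_b[OF subset_refl])
qed

lemma calB_subset_Psi_image: "\<B> \<subseteq> \<Psi> ` \<BB>"
proof -
  define S where "S = {(l, i, k) \<in> indices. i \<ge> 1}"
  then have S: "S \<subseteq> indices" by auto
  \<comment> \<open>Preimages under \<open>ham\<close> of the generators of \<B>; by linearity
    \<open>ham\<close> carries their span onto \<B>.\<close>
  define A where "A = range (\<lambda>\<beta>. \<bb> 1 0 0 + sum_\<bb> \<beta> S)"
  have "ham (\<bb> 1 0 0 + sum_\<bb> \<beta> S) = B 1 0 0 + sum_B \<beta> S" for \<beta>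
    by (simp only: linear_add[OF linear_ham] ham_sum_b[OF S] B_eq_ham)
  then have eq: "{B 1 0 0 + sum_B \<beta> S | \<beta>. True} = ham ` A"
    by (simp add: A_def image_image full_SetCompr_eq)
  have "A \<subseteq> {\<bb> 1 0 0 + sum_\<bb> \<beta> indices | \<beta>. True}"
  proof
    fix w assume "w \<in> A"
    then obtain \<beta> where "w = \<bb> 1 0 0 + sum_\<bb> \<beta> S" unfolding A_def by (rule rangeE)
    then have "w = \<bb> 1 0 0 + sum_\<bb> (\<lambda>s. if s \<in> S then \<beta> s else 0) indices"
      by (simp only: sum_b_restrict[OF S, of \<beta>])
    then show "w \<in> {\<bb> 1 0 0 + sum_\<bb> \<beta> indices | \<beta>. True}" by blast
  qed
  then have "span A \<subseteq> \<BB>"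
    unfolding \<BB>_def by (rule span_mono)
  have "\<B> = ham ` span A"
    unfolding \<B>_def S_def[symmetric] eq by (rule linear_span_image[OF linear_ham])
  also have "\<dots> \<subseteq> ham ` \<BB>" using \<open>span A \<subseteq> \<BB>\<close> by (rule image_mono)
  also have "ham ` \<BB> = \<Psi> ` \<BB>" by (rule image_cong) (simp_all add: Psi_eq_ham)
  finally show ?thesis .
qed

lemma calB_Psi_inv:
  assumes "v \<in> \<B>"
  shows "\<Psi>_inv v \<in> \<BB>" and "v = ham (\<Psi>_inv v)"
proof -
  have v: "v \<in> \<Psi> ` \<BB>" using assms calB_subset_Psi_image by blast
  then show "\<Psi>_inv v \<in> \<BB>" unfolding \<Psi>_inv_def by (rule inv_into_into)
  with f_inv_into_f[OF v] show "v = ham (\<Psi>_inv v)"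
    by (simp add: Psi_eq_ham \<Psi>_inv_def)
qed

section \<open>Rings of invariants\<close>

lemma generated_ring_subset_invariants:
  assumes "S \<subseteq> invariants v"
  shows "generated_ring S \<subseteq> invariants v"
proof
  fix f assume "f \<in> generated_ring S"
  then show "f \<in> invariants v"
  proof induction
    case (const c)
    have "vf_apply v 1 = 0" by (simp add: vf_apply_def)
    then show ?case
      by (simp add: invariants_def first_integral_def linear_cmul[OF linear_vf_apply])
  qed (use assms in \<open>auto simp: invariants_def first_integral_def vf_apply_mult
      linear_diff[OF linear_vf_apply]\<close>)
qed

text \<open>A coordinate is invariant when the matching component vanishes: \<open>M\<close> has no
  z-component; at l = i the weight of \<open>\<bb>\<close> is 0; at l = 2 i + 1 the string ends, so
  \<open>N\<close> annihilates \<open>\<bb>\<close>.\<close>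

lemma invariants_B:
  "Z \<in> invariants (B (-1) i k)"
  "Y \<in> invariants (B (int i) i k)"
  "X \<in> invariants (B (2 * int i + 1) i k)"
proof -
  show "Z \<in> invariants (B (-1) i k)"
    by (simp add: invariants_def first_integral_def B_def vf_apply_scaleR vf_apply_smult vf_apply_M)
  have "graded (i + 2 * k + 1) 0 (\<bb> (int i) i k)"
    using graded_b[of "int i" i k] by simp
  from graded_weight[OF this] show "Y \<in> invariants (B (int i) i k)"
    by (simp add: invariants_def first_integral_def B_eq_ham ham_coordinates)
  \<comment> \<open>With n = i + 1 the exponent is 2 n, so one more \<open>N\<close> reaches the
    power 2 n + 1 that annihilates \<open>Z ^ n\<close>.\<close>
  have "nat (2 * int i + 1 + 1) = 2 * (i + 1)" by simp
  then have "vf_apply N (\<bb> (2 * int i + 1) i k) = 0"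
    using N_pow_eq_0[of "i + 1"]
    unfolding \<bb>_def
    by (simp add: mult.commute[of _ "\<Delta> ^ k"] N_pow_Delta_mult vf_apply_Delta_mult
        linear_cmul[OF linear_vf_apply] linear_neg[OF linear_vf_apply])
  then show "X \<in> invariants (B (2 * int i + 1) i k)"
    by (simp add: invariants_def first_integral_def B_eq_ham ham_coordinates)
qed

section \<open>Functional independence\<close>

lemma poly_fun_superset:
  assumes "finite T" "support f \<subseteq> T"
  shows "poly_fun f p = (\<Sum>(a, b, c)\<in>T. coef f (a, b, c) * (p$1) ^ a * (p$2) ^ b * (p$3) ^ c)"
  unfolding poly_fun_def using assms
  by (intro sum.mono_neutral_left) (auto simp: support_def)

lemma poly_fun_add:
  assumes "is_polynomial f" "is_polynomial g"
  shows "poly_fun (f + g) p = poly_fun f p + poly_fun g p"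
proof -
  let ?T = "support f \<union> support g"
  have T: "finite ?T" "support (f + g) \<subseteq> ?T" "support f \<subseteq> ?T" "support g \<subseteq> ?T"
    using assms by (auto simp: is_polynomial_def support_def)
  show ?thesis
    unfolding poly_fun_superset[OF T(1,2)] poly_fun_superset[OF T(1,3)] poly_fun_superset[OF T(1,4)]
    by (simp add: sum.distrib[symmetric] case_prod_beta distrib_right)
qed

lemma poly_fun_scaleR:
  assumes "is_polynomial f"
  shows "poly_fun (r *\<^sub>R f) p = r * poly_fun f p"
proof -
  have T: "finite (support f)" "support (r *\<^sub>R f) \<subseteq> support f"
    using assms by (auto simp: is_polynomial_def support_def)
  show ?thesis
    unfolding poly_fun_superset[OF T] unfolding poly_fun_def
    by (simp add: sum_distrib_left case_prod_beta mult.assoc)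
qed

lemma support_shift:
  "support (X * f) = (\<lambda>(a, b, c). (Suc a, b, c)) ` support f"
  "support (Y * f) = (\<lambda>(a, b, c). (a, Suc b, c)) ` support f"
  "support (Z * f) = (\<lambda>(a, b, c). (a, b, Suc c)) ` support f"
  by (force simp: support_def coef_X_mult coef_Y_mult coef_Z_mult image_iff split: if_splits)+

lemma poly_fun_shift:
  "poly_fun (X * f) p = p$1 * poly_fun f p"
  "poly_fun (Y * f) p = p$2 * poly_fun f p"
  "poly_fun (Z * f) p = p$3 * poly_fun f p"
  unfolding poly_fun_def support_shift
  by (subst sum.reindex; force simp: inj_on_def coef_X_mult coef_Y_mult coef_Z_mult
      sum_distrib_left case_prod_beta intro!: sum.cong)+

lemma is_polynomial_scaleR: "is_polynomial f \<Longrightarrow> is_polynomial (r *\<^sub>R f)"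
  unfolding is_polynomial_def
  by (rule finite_subset[of _ "support f"]) (auto simp: support_def)

lemma is_polynomial_shift:
  assumes "is_polynomial f"
  shows "is_polynomial (X * f)" "is_polynomial (Y * f)" "is_polynomial (Z * f)"
  using assms by (simp_all add: is_polynomial_def support_shift)

lemma is_polynomial_d:
  assumes "is_polynomial f"
  shows "is_polynomial (dx f)" "is_polynomial (dy f)" "is_polynomial (dz f)"
proof -
  have "support (dx f) \<subseteq> (\<lambda>(a, b, c). (a - 1, b, c)) ` support f"
    "support (dy f) \<subseteq> (\<lambda>(a, b, c). (a, b - 1, c)) ` support f"
    "support (dz f) \<subseteq> (\<lambda>(a, b, c). (a, b, c - 1)) ` support f"
    by (force simp: support_def image_iff)+
  with assms show "is_polynomial (dx f)" "is_polynomial (dy f)" "is_polynomial (dz f)"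
    unfolding is_polynomial_def by (meson finite_imageI finite_subset)+
qed

lemma graded_is_polynomial:
  assumes "graded d w f"
  shows "is_polynomial f"
  unfolding is_polynomial_def
proof (rule finite_subset)
  show "support f \<subseteq> {..d} \<times> {..d} \<times> {..d}"
    using assms by (fastforce simp: graded_def support_def)
qed simp

lemma is_polynomial_1: "is_polynomial 1"
  using graded_is_polynomial[OF graded_Z_pow[of 0]] by simp

lemma is_polynomial_Delta: "is_polynomial \<Delta>"
proof -
  have "\<Delta> = \<Delta> ^ 1 * Z ^ 0" by simp
  then show ?thesis
    using graded_is_polynomial[OF graded_Delta_pow_mult[OF graded_Z_pow]] by metis
qed

lemma poly_fun_1: "poly_fun 1 p = 1"
proof -
  have "support 1 = {(0, 0, 0)}" by (auto simp: support_def coef_1 split: if_splits)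
  then show ?thesis by (simp add: poly_fun_def coef_1)
qed

text \<open>Brings the formal derivatives into the shape that termwise differentiation produces.
  Monomials free of the variable, absent after the shift of exponents, return with the factor 0,
  whatever their truncated exponent.\<close>

lemma poly_fun_d:
  assumes "is_polynomial f"
  shows "poly_fun (dx f) p =
      (\<Sum>(a, b, c)\<in>support f. coef f (a, b, c) * (real a * (p$1) ^ (a - 1)) * (p$2) ^ b * (p$3) ^ c)"
    and "poly_fun (dy f) p =
      (\<Sum>(a, b, c)\<in>support f. coef f (a, b, c) * (p$1) ^ a * (real b * (p$2) ^ (b - 1)) * (p$3) ^ c)"
    and "poly_fun (dz f) p =
      (\<Sum>(a, b, c)\<in>support f. coef f (a, b, c) * (p$1) ^ a * (p$2) ^ b * (real c * (p$3) ^ (c - 1)))"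
proof -
  have fin: "finite (support f)" using assms by (simp add: is_polynomial_def)
  have "poly_fun (dx f) p = (\<Sum>(a, b, c)\<in>{(a, b, c) \<in> support f. a \<noteq> 0}.
      coef f (a, b, c) * (real a * (p$1) ^ (a - 1)) * (p$2) ^ b * (p$3) ^ c)"
    unfolding poly_fun_def
    by (rule sum.reindex_bij_witness[where i = "\<lambda>(a, b, c). (a - 1, b, c)"
        and j = "\<lambda>(a, b, c). (Suc a, b, c)"]) (auto simp: support_def simp del: of_nat_Suc)
  also have "\<dots> = (\<Sum>(a, b, c)\<in>support f.
      coef f (a, b, c) * (real a * (p$1) ^ (a - 1)) * (p$2) ^ b * (p$3) ^ c)"
    using fin by (intro sum.mono_neutral_left) auto
  finally show "poly_fun (dx f) p = \<dots>" .
  have "poly_fun (dy f) p = (\<Sum>(a, b, c)\<in>{(a, b, c) \<in> support f. b \<noteq> 0}.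
      coef f (a, b, c) * (p$1) ^ a * (real b * (p$2) ^ (b - 1)) * (p$3) ^ c)"
    unfolding poly_fun_def
    by (rule sum.reindex_bij_witness[where i = "\<lambda>(a, b, c). (a, b - 1, c)"
        and j = "\<lambda>(a, b, c). (a, Suc b, c)"]) (auto simp: support_def simp del: of_nat_Suc)
  also have "\<dots> = (\<Sum>(a, b, c)\<in>support f.
      coef f (a, b, c) * (p$1) ^ a * (real b * (p$2) ^ (b - 1)) * (p$3) ^ c)"
    using fin by (intro sum.mono_neutral_left) auto
  finally show "poly_fun (dy f) p = \<dots>" .
  have "poly_fun (dz f) p = (\<Sum>(a, b, c)\<in>{(a, b, c) \<in> support f. c \<noteq> 0}.
      coef f (a, b, c) * (p$1) ^ a * (p$2) ^ b * (real c * (p$3) ^ (c - 1)))"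
    unfolding poly_fun_def
    by (rule sum.reindex_bij_witness[where i = "\<lambda>(a, b, c). (a, b, c - 1)"
        and j = "\<lambda>(a, b, c). (a, b, Suc c)"]) (auto simp: support_def simp del: of_nat_Suc)
  also have "\<dots> = (\<Sum>(a, b, c)\<in>support f.
      coef f (a, b, c) * (p$1) ^ a * (p$2) ^ b * (real c * (p$3) ^ (c - 1)))"
    using fin by (intro sum.mono_neutral_left) auto
  finally show "poly_fun (dz f) p = \<dots>" .
qed

lemma poly_fun_has_derivative:
  assumes "is_polynomial f"
  shows "(poly_fun f has_derivative
    (\<lambda>h. poly_fun (dx f) p * h$1 + poly_fun (dy f) p * h$2 + poly_fun (dz f) p * h$3)) (at p)"
proof -
  have nth: "((\<lambda>p::real^3. p $ j) has_derivative (\<lambda>h. h $ j)) (at p)" for j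
    by (rule bounded_linear.has_derivative[OF bounded_linear_vec_nth has_derivative_ident])
  have "((\<lambda>p::real^3. coef f (a, b, c) * (p$1) ^ a * (p$2) ^ b * (p$3) ^ c) has_derivative
      (\<lambda>h. coef f (a, b, c) * (real a * (p$1) ^ (a - 1)) * (p$2) ^ b * (p$3) ^ c * h$1 +
        coef f (a, b, c) * (p$1) ^ a * (real b * (p$2) ^ (b - 1)) * (p$3) ^ c * h$2 +
        coef f (a, b, c) * (p$1) ^ a * (p$2) ^ b * (real c * (p$3) ^ (c - 1)) * h$3)) (at p)" for a b c
    by (rule derivative_eq_intros nth refl)+ (simp add: algebra_simps)
  then have "((\<lambda>p. \<Sum>(a, b, c)\<in>support f. coef f (a, b, c) * (p$1) ^ a * (p$2) ^ b * (p$3) ^ c)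
      has_derivative (\<lambda>h. \<Sum>(a, b, c)\<in>support f.
        coef f (a, b, c) * (real a * (p$1) ^ (a - 1)) * (p$2) ^ b * (p$3) ^ c * h$1 +
        coef f (a, b, c) * (p$1) ^ a * (real b * (p$2) ^ (b - 1)) * (p$3) ^ c * h$2 +
        coef f (a, b, c) * (p$1) ^ a * (p$2) ^ b * (real c * (p$3) ^ (c - 1)) * h$3)) (at p)"
    unfolding case_prod_beta by (intro has_derivative_sum)
  then show ?thesis
    unfolding poly_fun_d[OF assms]
    unfolding poly_fun_def[abs_def]
    by (simp only: case_prod_unfold sum.distrib sum_distrib_right)
qed

lemma fun_gradient_poly_fun:
  assumes "is_polynomial f"
  shows "fun_gradient (poly_fun f) p = vector [poly_fun (dx f) p, poly_fun (dy f) p, poly_fun (dz f) p]"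
  unfolding fun_gradient_def frechet_derivative_at[OF poly_fun_has_derivative[OF assms], symmetric]
  by (simp add: vec_eq_iff forall_3 axis_def)

section \<open>Zero sets of homogeneous polynomials\<close>

text \<open>
  Of the \<open>m\<close> translates of \<open>S\<close> by the vectors \<open>(j / m) e\<close>, at most \<open>d\<close> contain a given point.
\<close>

lemma negligible_if_card_on_lines_le:
  fixes S :: "'a::euclidean_space set"
  assumes S: "compact S"
    and fin: "\<And>x. finite {t \<in> {0<..1}. x - t *\<^sub>R e \<in> S}"
    and card: "\<And>x. card {t \<in> {0<..1}. x - t *\<^sub>R e \<in> S} \<le> d"
  shows "negligible S"
proof -
  obtain r where r: "\<And>x. x \<in> S \<Longrightarrow> norm x \<le> r"
    using compact_imp_bounded[OF S] by (auto simp: bounded_iff)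
  \<comment> \<open>The translation vectors have norm at most \<open>norm e\<close>, so this ball
    contains all the translates.\<close>
  let ?K = "cball (0::'a) (r + norm e)"
  let ?C = "real d * measure lebesgue ?K"
  have S_meas: "S \<in> lmeasurable" using S by (rule lmeasurable_compact)
  \<comment> \<open>The m translates have equal volume and overlap at most d-fold inside
    \<open>?K\<close>. As m is arbitrary, the volume of \<open>S\<close> must be 0.\<close>
  have le: "real m * measure lebesgue S \<le> ?C" if "m > 0" for m
  proof -
    define t where "t j = real (Suc j) / real m" for j
    define T where "T j = (+) (t j *\<^sub>R e) ` S" for j
    have t: "t j \<in> {0<..1}" if "j < m" for j using that by (auto simp: t_def)
    have T_meas: "T j \<in> lmeasurable" for j
      unfolding T_def using S_meas by (rule measurable_translation)
    have pointwise: "(\<Sum>j<m. indicat_real (T j) x) \<le> real d * indicat_real ?K x" for x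
    proof (cases "\<exists>j<m. x \<in> T j")
      case True
      then obtain j s where j: "j < m" "s \<in> S" "x = t j *\<^sub>R e + s" by (auto simp: T_def)
      have "norm x \<le> \<bar>t j\<bar> * norm e + norm s"
        unfolding j using norm_triangle_ineq[of "t j *\<^sub>R e" s] by simp
      also have "\<bar>t j\<bar> * norm e \<le> norm e"
        using t[OF j(1)] by (intro mult_left_le_one_le) auto
      finally have "x \<in> ?K" using r[OF j(2)] by simp
      have "(\<Sum>j<m. indicat_real (T j) x) = real (card {j \<in> {..<m}. x \<in> T j})"
        by (simp add: indicator_def sum.If_cases Int_def)
      also have "card {j \<in> {..<m}. x \<in> T j} \<le> card {t \<in> {0<..1}. x - t *\<^sub>R e \<in> S}"
      proof (rule card_inj_on_le[OF _ _ fin])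
        show "inj_on t {j \<in> {..<m}. x \<in> T j}"
          using \<open>m > 0\<close> by (auto simp: inj_on_def t_def)
        show "t ` {j \<in> {..<m}. x \<in> T j} \<subseteq> {t \<in> {0<..1}. x - t *\<^sub>R e \<in> S}"
          using t by (auto simp: T_def)
      qed
      also have "\<dots> \<le> d" by (rule card)
      finally show ?thesis using \<open>x \<in> ?K\<close> by simp
    next
      case False
      then have "(\<Sum>j<m. indicat_real (T j) x) = 0" by (auto intro!: sum.neutral)
      then show ?thesis by simp
    qed
    have int: "integrable lebesgue (indicat_real (T j))" for j
      using T_meas by (simp add: lmeasurable_iff_integrable)
    have "real m * measure lebesgue S = (\<Sum>j<m. measure lebesgue (T j))"
      by (simp add: T_def measure_translation)
    also have "\<dots> = (\<Sum>j<m. \<integral>x. indicat_real (T j) x \<partial>lebesgue)"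
      by simp
    also have "\<dots> = (\<integral>x. (\<Sum>j<m. indicat_real (T j) x) \<partial>lebesgue)"
      using int by (intro Bochner_Integration.integral_sum[symmetric])
    also have "\<dots> \<le> (\<integral>x. real d * indicat_real ?K x \<partial>lebesgue)"
    proof (rule integral_mono)
      show "integrable lebesgue (\<lambda>x. \<Sum>j<m. indicat_real (T j) x)"
        using int by (intro Bochner_Integration.integrable_sum)
      show "integrable lebesgue (\<lambda>x. real d * indicat_real ?K x)"
        using lmeasurable_cball by (intro integrable_mult_right) (simp add: lmeasurable_iff_integrable)
    qed (rule pointwise)
    also have "\<dots> = ?C" by simp
    finally show ?thesis .
  qed
  have "measure lebesgue S = 0"
  proof (rule ccontr)
    assume "measure lebesgue S \<noteq> 0"
    then have pos: "measure lebesgue S > 0" by (simp add: zero_less_measure_iff)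
    then obtain m where m: "?C < real m * measure lebesgue S" by (metis ex_less_of_nat_mult)
    have "0 \<le> ?C" by (intro mult_nonneg_nonneg measure_nonneg of_nat_0_le_iff)
    from le_less_trans[OF this m] have "m > 0" by (simp add: zero_less_mult_iff)
    from le[OF this] m show False by simp
  qed
  with S_meas show ?thesis by (simp add: negligible_iff_measure)
qed

lemma poly_fun_homogeneous:
  assumes "graded n w f"
  shows "poly_fun f (r *\<^sub>R p) = r ^ n * poly_fun f p"
  unfolding poly_fun_def sum_distrib_left
proof (rule sum.cong[OF refl], clarify)
  fix a b c assume "(a, b, c) \<in> support f"
  then have "n = a + b + c" using assms by (auto simp: graded_def support_def)
  then show "coef f (a, b, c) * (r *\<^sub>R p) $ 1 ^ a * (r *\<^sub>R p) $ 2 ^ b * (r *\<^sub>R p) $ 3 ^ c =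
      r ^ n * (coef f (a, b, c) * p $ 1 ^ a * p $ 2 ^ b * p $ 3 ^ c)"
    by (simp add: power_add power_mult_distrib)
qed

text \<open>The parameter multiplies \<open>x\<close> rather than \<open>e\<close>, which makes the
  constant term the value at \<open>e\<close>, nonzero in the application.\<close>

lemma poly_fun_on_line:
  assumes "graded n w f"
  obtains P where "degree P \<le> n" and "\<And>s. poly P s = poly_fun f (e - s *\<^sub>R x)"
proof
  let ?q = "\<lambda>j. [:e $ j, - x $ j:]"
  let ?P = "\<Sum>(a, b, c)\<in>support f. smult (coef f (a, b, c)) (?q 1 ^ a * ?q 2 ^ b * ?q 3 ^ c)"
  show "poly ?P s = poly_fun f (e - s *\<^sub>R x)" for s
    by (simp add: poly_sum poly_fun_def case_prod_beta mult.assoc)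
  have deg: "degree (?q j ^ k) \<le> k" for j k
    using degree_power_le[of "?q j" k] by (simp add: order_trans[OF _ mult_left_mono] split: if_splits)
  show "degree ?P \<le> n"
  proof (rule degree_sum_le)
    show "finite (support f)"
      using graded_is_polynomial[OF assms] by (simp add: is_polynomial_def)
    fix m assume "m \<in> support f"
    then obtain a b c where m: "m = (a, b, c)" "a + b + c = n"
      using assms by (cases m) (auto simp: graded_def support_def)
    have "degree (?q 1 ^ a * ?q 2 ^ b * ?q 3 ^ c) \<le> a + b + c"
      by (meson deg add_mono degree_mult_le order_trans)
    with m show "degree (case m of (a, b, c) \<Rightarrow>
        smult (coef f (a, b, c)) (?q 1 ^ a * ?q 2 ^ b * ?q 3 ^ c)) \<le> n"
      by (auto intro: order_trans[OF degree_smult_le])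
  qed
qed

text \<open>By homogeneity f(x - t e) = (-t)^n f(e - x / t), so the zeros t in (0, 1] on a line in
  direction \<open>e\<close> correspond to roots 1 / t of a nonzero polynomial of degree at most
  n.\<close>

lemma negligible_zero_set:
  assumes f: "graded n w f" and e: "poly_fun f e \<noteq> 0"
  shows "negligible {p. poly_fun f p = 0}"
proof -
  \<comment> \<open>Intersecting with balls provides compactness; countably many of them exhaust the
    zero set.\<close>
  let ?S = "\<lambda>k::nat. cball 0 (real k) \<inter> {p. poly_fun f p = 0}"
  have cont: "continuous_on UNIV (poly_fun f)"
    using poly_fun_has_derivative[OF graded_is_polynomial[OF f]] has_derivative_continuous
    by (blast intro: continuous_at_imp_continuous_on)
  have "negligible (?S k)" for k
  proof (rule negligible_if_card_on_lines_le)
    show "compact (?S k)"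
      using closed_Collect_eq[OF cont continuous_on_const] by (intro compact_Int_closed) auto
    fix x :: "real ^ 3"
    obtain P where deg: "degree P \<le> n" and P: "\<And>s. poly P s = poly_fun f (e - s *\<^sub>R x)"
      using poly_fun_on_line[OF f] by blast
    have "poly P 0 \<noteq> 0" using e by (simp add: P)
    then have "P \<noteq> 0" by auto
    let ?L = "{t \<in> {0<..1}. x - t *\<^sub>R e \<in> ?S k}"
    have sub: "(\<lambda>t. 1 / t) ` ?L \<subseteq> {s. poly P s = 0}"
    proof clarify
      fix t :: real assume t: "t \<in> {0<..1}" "poly_fun f (x - t *\<^sub>R e) = 0"
      have "x - t *\<^sub>R e = (- t) *\<^sub>R (e - (1 / t) *\<^sub>R x)"
        using t by (simp add: scaleR_diff_right)
      with t(2) have "(- t) ^ n * poly_fun f (e - (1 / t) *\<^sub>R x) = 0"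
        by (simp only: poly_fun_homogeneous[OF f])
      then show "poly P (1 / t) = 0" using t(1) by (simp add: P)
    qed
    have inj: "inj_on (\<lambda>t. 1 / t) ?L" by (auto simp: inj_on_def)
    from sub poly_roots_finite[OF \<open>P \<noteq> 0\<close>] show "finite ?L"
      using inj by (meson finite_imageD finite_subset)
    have "card ?L \<le> card {s. poly P s = 0}"
      by (rule card_inj_on_le[OF inj sub poly_roots_finite[OF \<open>P \<noteq> 0\<close>]])
    also have "\<dots> \<le> n" using card_poly_roots_bound[OF \<open>P \<noteq> 0\<close>] deg by linarith
    finally show "card ?L \<le> n" .
  qed
  then have "negligible (\<Union>k. ?S k)" by (intro negligible_Union_nat) auto
  also have "(\<Union>k. ?S k) = {p. poly_fun f p = 0}"
    by (auto simp: real_arch_simple)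
  finally show ?thesis .
qed

section \<open>Gradients of rank 2 almost everywhere\<close>

lemma poly_fun_N_pow_nonzero:
  assumes "j \<le> 2 * n"
  shows "poly_fun ((vf_apply N ^^ j) (Z ^ n)) 1 \<noteq> 0"
proof -
  let ?f = "(vf_apply N ^^ j) (Z ^ n)"
  have fin: "finite (support ?f)"
    using graded_is_polynomial[OF graded_N_pow] by (simp add: is_polynomial_def)
  have "support ?f \<noteq> {}"
  proof
    assume "support ?f = {}"
    then have "?f = 0" by (intro series_eqI) (auto simp: support_def)
    with N_pow_nonzero[OF assms] show False by simp
  qed
  then have "0 < (\<Sum>m\<in>support ?f. coef ?f m)"
    using fin N_pow_nonneg by (intro sum_pos) (auto simp: support_def order_less_le)
  \<comment> \<open>Here \<open>1\<close> is the vector (1, 1, 1), at which every monomial has the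
    value 1.\<close>
  also have "\<dots> = poly_fun ?f 1"
    by (simp add: poly_fun_def case_prod_beta)
  finally show ?thesis by simp
qed

text \<open>The two minors are the outer components of the cross product of \<open>u\<close> and
  \<open>v\<close>, where \<open>N\<close> and \<open>M\<close> appear in the application.\<close>

lemma rank_eq_2:
  fixes u v :: "real ^ 3"
  assumes "u$2 * v$3 \<noteq> u$3 * v$2 \<or> u$1 * v$2 \<noteq> u$2 * v$1"
  shows "rank (vector [u, v] :: real ^ 3 ^ 2) = 2"
proof -
  let ?A = "vector [u, v] :: real ^ 3 ^ 2"
  have "rows ?A = (\<lambda>i. row i ?A) ` UNIV" by (auto simp: rows_def)
  moreover have "row 1 ?A = u" "row 2 ?A = v" by (simp_all add: row_def vec_eq_iff)
  ultimately have "rows ?A = {u, v}" by (simp add: UNIV_2)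
  moreover have "v \<noteq> 0" "u \<noteq> v" using assms by auto
  moreover have "u \<notin> span {v}" using assms by (auto simp: span_singleton)
  ultimately show ?thesis
    by (simp add: row_rank_def dim_eq_card_independent independent_insert)
qed

lemma functionally_independent_b:
  assumes "-1 \<le> l" "l \<le> 2 * int i + 1"
  shows "functionally_independent (poly_fun (\<bb> l i 0)) (poly_fun \<Delta>)"
proof -
  let ?b = "\<bb> l i 0"
  define n j where "n = i + 1" and "j = nat (l + 1)"
  have j: "j \<le> 2 * n" using assms by (simp add: n_def j_def)
  define c where "c = - (1 / (real (i + 1) * kappa (nat (l + 1)) (2 * i + 2)))"
  have "c \<noteq> 0" by (simp add: c_def kappa_def)
  have b: "?b = c *\<^sub>R (vf_apply N ^^ j) (Z ^ n)"
    by (simp add: \<bb>_def c_def n_def j_def)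
  have poly_b: "is_polynomial ?b"
    using graded_b[OF assms(1)] by (rule graded_is_polynomial)
  have N_b: "poly_fun (vf_apply N ?b) p = p$1 * poly_fun (dy ?b) p + 2 * p$2 * poly_fun (dz ?b) p"
    and M_b: "poly_fun (vf_apply M ?b) p = 2 * p$2 * poly_fun (dx ?b) p + p$3 * poly_fun (dy ?b) p" for p
    using is_polynomial_d[OF poly_b]
    by (simp_all add: vf_apply_N vf_apply_M mult.assoc scaleR_2_eq poly_fun_add poly_fun_scaleR
        poly_fun_shift is_polynomial_shift is_polynomial_scaleR)
  have grad_Delta: "fun_gradient (poly_fun \<Delta>) p = vector [p$3, - 2 * p$2, p$1]" for p
  proof -
    have "poly_fun X p = p$1" "poly_fun Z p = p$3" "poly_fun (- 2 * Y) p = - 2 * p$2"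
      using poly_fun_shift[of 1 p] poly_fun_scaleR[OF is_polynomial_shift(2)[OF is_polynomial_1], of "-2" p]
      by (simp_all add: poly_fun_1 scaleR_2_eq)
    then show ?thesis by (simp add: fun_gradient_poly_fun[OF is_polynomial_Delta])
  qed
  \<comment> \<open>Past the start of the string \<open>M\<close> leads one step back; at the start,
    where \<open>M\<close> gives 0, \<open>N\<close> leads one step forward, which stays within the
    string because n is at least 1.\<close>
  obtain q r where q: "q \<le> 2 * n" and r: "r \<noteq> 0"
    and eq: "vf_apply N ?b = r *\<^sub>R (vf_apply N ^^ q) (Z ^ n) \<or>
      vf_apply M ?b = r *\<^sub>R (vf_apply N ^^ q) (Z ^ n)"
  proof (cases j)
    case 0
    then have "vf_apply N ?b = c *\<^sub>R (vf_apply N ^^ 1) (Z ^ n)"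
      by (simp add: b linear_cmul[OF linear_vf_apply])
    then show ?thesis using that[of 1 c] \<open>c \<noteq> 0\<close> by (simp add: n_def)
  next
    case (Suc q)
    then have M_b: "vf_apply M ?b = (c * (real (Suc q) * (2 * real n - real q))) *\<^sub>R (vf_apply N ^^ q) (Z ^ n)"
      by (simp only: b linear_cmul[OF linear_vf_apply] M_N_pow scaleR_scaleR)
    have nz: "c * (real (Suc q) * (2 * real n - real q)) \<noteq> 0"
      using \<open>c \<noteq> 0\<close> j Suc by simp
    show ?thesis by (rule that[OF _ nz disjI2[OF M_b]]) (use j Suc in simp)
  qed
  let ?g = "(vf_apply N ^^ q) (Z ^ n)"
  have "AE p in lebesgue. p \<notin> {p. poly_fun ?g p = 0}"
    using negligible_zero_set[OF graded_N_pow poly_fun_N_pow_nonzero[OF q]]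
    by (intro AE_not_in) (simp add: negligible_iff_null_sets)
  then have "AE p in lborel. poly_fun ?g p \<noteq> 0"
    by (simp add: AE_completion_iff)
  then have "AE p in lborel. rank (vector [fun_gradient (poly_fun ?b) p,
      fun_gradient (poly_fun \<Delta>) p] :: real ^ 3 ^ 2) = 2"
  proof (rule AE_mp, intro AE_I2 impI rank_eq_2)
    fix p assume "poly_fun ?g p \<noteq> 0"
    then have "poly_fun (r *\<^sub>R ?g) p \<noteq> 0"
      using r by (simp add: poly_fun_scaleR[OF graded_is_polynomial[OF graded_N_pow]])
    then have "poly_fun (vf_apply N ?b) p \<noteq> 0 \<or> poly_fun (vf_apply M ?b) p \<noteq> 0"
      using eq by metis
    \<comment> \<open>As the gradient of \<Delta> is (z, -2 y, x), the first minor is the value of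
      \<open>vf_apply N ?b\<close> and the second is minus that of
      \<open>vf_apply M ?b\<close>.\<close>
    then show "fun_gradient (poly_fun ?b) p $ 2 * fun_gradient (poly_fun \<Delta>) p $ 3 \<noteq>
        fun_gradient (poly_fun ?b) p $ 3 * fun_gradient (poly_fun \<Delta>) p $ 2 \<or>
      fun_gradient (poly_fun ?b) p $ 1 * fun_gradient (poly_fun \<Delta>) p $ 2 \<noteq>
        fun_gradient (poly_fun ?b) p $ 2 * fun_gradient (poly_fun \<Delta>) p $ 1"
      by (auto simp: N_b M_b grad_Delta fun_gradient_poly_fun[OF poly_b] algebra_simps)
  qed
  then show ?thesis
    unfolding functionally_independent_def
    using poly_fun_has_derivative[OF poly_b] poly_fun_has_derivative[OF is_polynomial_Delta]
    by (auto simp: differentiable_def)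
qed


theorem theorem4p3:
  shows
    "((\<forall>l i k. -1 \<le> l \<and> l \<le> 2 * int i + 1 \<longrightarrow>
        is_polynomial (\<bb> l i 0) \<and> is_polynomial \<Delta> \<and>
        first_integral (B l i k) (\<bb> l i 0) \<and> first_integral (B l i k) \<Delta>) \<and>
      (\<forall>v \<in> \<B>. v \<in> \<Psi> ` \<BB> \<and> \<Psi>_inv v \<in> \<BB> \<and>
        first_integral v (\<Psi>_inv v) \<and> first_integral v \<Delta>))
     \<and>
     ((\<forall>l i k. -1 \<le> l \<and> l \<le> 2 * int i + 1 \<longrightarrow>
        B l i k = \<Delta> ^ k *s (gradient \<Delta> \<times>\<^sub>v gradient (\<bb> l i 0))) \<and>
      (\<forall>v \<in> \<B>. clebsch_potentials v \<Delta> (\<Psi>_inv v)))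
     \<and>
     (\<forall>l i. -1 \<le> l \<and> l \<le> 2 * int i + 1 \<longrightarrow>
        first_integral (B l i 0) (\<bb> l i 0) \<and> first_integral (B l i 0) \<Delta> \<and>
        functionally_independent (poly_fun (\<bb> l i 0)) (poly_fun \<Delta>))
     \<and>
     (\<forall>i k. generated_ring {\<Delta>, Z} \<subseteq> invariants (B (-1) i k) \<and>
        generated_ring {\<Delta>, Y} \<subseteq> invariants (B (int i) i k) \<and>
        generated_ring {\<Delta>, X} \<subseteq> invariants (B (2 * int i + 1) i k))"
proof (intro conjI allI impI ballI)
  fix l :: int and i k :: nat
  assume l: "-1 \<le> l \<and> l \<le> 2 * int i + 1"
  show "is_polynomial (\<bb> l i 0)"
    using graded_b l graded_is_polynomial by blast
  show "is_polynomial \<Delta>" by (rule is_polynomial_Delta)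
  \<comment> \<open>Kept general in \<open>k\<close>, since the claims on independent first
    integrals use \<open>k = 0\<close>.\<close>
  have B: "B l i k = \<Delta> ^ k *s ham (\<bb> l i 0)" for k
    by (subst B_eq_ham, subst b_eq) (rule ham_Delta_mult)
  then show "B l i k = \<Delta> ^ k *s (gradient \<Delta> \<times>\<^sub>v gradient (\<bb> l i 0))"
    by (simp only: ham_def)
  have "first_integral (B l i k) (\<bb> l i 0)" "first_integral (B l i k) \<Delta>" for k
    by (simp_all add: first_integral_def B vf_apply_smult ham_self ham_Delta)
  then show "first_integral (B l i k) (\<bb> l i 0)" "first_integral (B l i k) \<Delta>"
    "first_integral (B l i 0) (\<bb> l i 0)" "first_integral (B l i 0) \<Delta>"
    by blast+
  show "functionally_independent (poly_fun (\<bb> l i 0)) (poly_fun \<Delta>)"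
    using l by (intro functionally_independent_b) auto
next
  fix v assume v: "v \<in> \<B>"
  show "v \<in> \<Psi> ` \<BB>" using v calB_subset_Psi_image by blast
  show "\<Psi>_inv v \<in> \<BB>" using v by (rule calB_Psi_inv)
  note ham = calB_Psi_inv(2)[OF v]
  show "first_integral v (\<Psi>_inv v)" "first_integral v \<Delta>"
    by (metis first_integral_def ham ham_self ham_Delta)+
  \<comment> \<open>The order of the potentials is that of the cross product in
    \<open>ham\<close>.\<close>
  then show "clebsch_potentials v \<Delta> (\<Psi>_inv v)"
    using ham by (simp add: clebsch_potentials_def ham_def)
next
  fix i k
  show "generated_ring {\<Delta>, Z} \<subseteq> invariants (B (-1) i k)"
    "generated_ring {\<Delta>, Y} \<subseteq> invariants (B (int i) i k)"
    "generated_ring {\<Delta>, X} \<subseteq> invariants (B (2 * int i + 1) i k)"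
    using invariants_B[of i k]
    by (intro generated_ring_subset_invariants;
        simp add: invariants_def first_integral_def B_eq_ham ham_Delta)+
qed

end
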